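(* Let $d\ge1$ and let $T=T(z)$ be the formal power series with $T(0)=1$ and $T=1+zT^{2d+1}$. Let $X=X(z)$ denote any of the $d$ small solutions of the characteristic equation $1=zT^{2d}\sum_{\ell=-d}^{d}X^{\ell}$. Then the recurrence relation $$T_j=1+z\prod_{\ell=-d}^{d}T_{j+\ell},\qquad j\in\mathbb{Z},$$ admits the solution with free parameter $\lambda$ $$T_j=T\cdot\frac{(1-\lambda X^{d+1+j})(1-\lambda X^{2d+3+j})}{(1-\lambda X^{d+2+j})(1-\lambda X^{2d+2+j})},\qquad j\in\mathbb{Z}.$$ Here $\lambda$ is any element, independent of $j$, of the field of Puiseux series in $z$ such that $1-\lambda X^k\ne0$ for all $k\in\mathbb{Z}$.
   Context: All identities are in the field $K=\bigcup_{m\ge1}\mathbb{C}((z^{1/m}))$ of Puiseux series. A small solution of the characteristic equation is a solution $X\in K$ of positive order in $z$ (i.e. tending to $0$ as $z\to0$); there are $d$ of them. *)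

theory Defs
  imports "HOL-Computational_Algebra.Formal_Laurent_Series"
begin

unbundle fps_syntax

section \<open>The field of Puiseux series\<close>

text \<open>
  For \<open>m > 0\<close> the pair \<open>(m, f)\<close> stands for the series \<open>f(z\<^sup>1\<^sup>/\<^sup>m)\<close>. Two such
  pairs \<open>(m, f)\<close> and \<open>(n, g)\<close> denote the same series iff they agree after rewriting both in terms
  of \<open>t = z\<^sup>1\<^sup>/\<^sup>(\<^sup>m\<^sup>n\<^sup>)\<close>, i.e. iff \<open>f(t\<^sup>n) = g(t\<^sup>m)\<close>. The quotient is thus the union
  of the fields of Laurent series in \<open>z\<^sup>1\<^sup>/\<^sup>m\<close> over all \<open>m > 0\<close>.
\<close>

definition puiseux_rel :: "nat \<times> 'a :: zero fls \<Rightarrow> nat \<times> 'a fls \<Rightarrow> bool" where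
  "puiseux_rel p q \<longleftrightarrow> fst p > 0 \<and> fst q > 0 \<and>
     fls_compose_power (snd p) (fst q) = fls_compose_power (snd q) (fst p)"

lemma fls_compose_power_compose_power:
  assumes "m > 0" "n > 0"
  shows   "fls_compose_power (fls_compose_power f m) n = fls_compose_power f (m * n)"
proof (rule fls_eqI)
  fix k :: int
  show "fls_compose_power (fls_compose_power f m) n $$ k = fls_compose_power f (m * n) $$ k"
  proof (cases "int n dvd k")
    case True
    then obtain l where k: "k = int n * l" by (elim dvdE)
    have "int m * int n dvd int n * l \<longleftrightarrow> int m dvd l"
      using assms by (simp add: mult.commute)
    moreover have "(int n * l) div (int m * int n) = l div int m"
      using assms by (simp add: mult.commute)
    ultimately show ?thesis
      using assms by (simp add: k fls_nth_compose_power)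
  next
    case False
    moreover have "\<not> int m * int n dvd k"
      using False dvd_mult_right by blast
    ultimately show ?thesis
      using assms by (simp add: fls_nth_compose_power)
  qed
qed

lemma fls_compose_power_1_right [simp]: "fls_compose_power f (Suc 0) = f"
  by (rule fls_eqI) (simp add: fls_nth_compose_power)

lemma fls_compose_power_eq_iff:
  assumes "d > 0"
  shows   "fls_compose_power f d = fls_compose_power g d \<longleftrightarrow> f = g"
proof
  assume eq: "fls_compose_power f d = fls_compose_power g d"
  show "f = g"
  proof (rule fls_eqI)
    fix k :: int
    have "fls_compose_power f d $$ (int d * k) = fls_compose_power g d $$ (int d * k)"
      by (simp only: eq)
    thus "f $$ k = g $$ k"
      using assms by (simp add: fls_nth_compose_power)
  qed
qed simp

lemma fls_compose_power_eq_0_iff: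
  assumes "d > 0"
  shows   "fls_compose_power f d = 0 \<longleftrightarrow> f = 0"
  using fls_compose_power_eq_iff[OF assms, of f 0] by simp

lemma fls_compose_power_inverse:
  fixes f :: "'a :: field fls"
  assumes "d > 0"
  shows   "fls_compose_power (inverse f) d = inverse (fls_compose_power f d)"
proof (cases "f = 0")
  case False
  have "fls_compose_power f d * fls_compose_power (inverse f) d = fls_compose_power (f * inverse f) d"
    by simp
  also have "\<dots> = 1"
    using False assms by simp
  finally show ?thesis
    by (metis inverse_unique)
qed simp

lemma fls_subdegree_compose_power:
  assumes "d > 0"
  shows   "fls_subdegree (fls_compose_power f d) = int d * fls_subdegree f"
proof (cases "f = 0")
  case False
  show ?thesis
  proof (rule fls_subdegree_eqI)
    show "fls_compose_power f d $$ (int d * fls_subdegree f) \<noteq> 0"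
      using assms False by (simp add: fls_nth_compose_power)
  next
    fix k assume k: "k < int d * fls_subdegree f"
    show "fls_compose_power f d $$ k = 0"
    proof (cases "int d dvd k")
      case True
      then obtain l where "k = int d * l" by (elim dvdE)
      with k assms show ?thesis
        by (simp add: fls_nth_compose_power)
    qed (use assms in \<open>simp add: fls_nth_compose_power\<close>)
  qed
qed simp

lemma puiseux_rel_trans:
  assumes "puiseux_rel p q" "puiseux_rel q r"
  shows   "puiseux_rel p r"
proof -
  obtain m f n g k h where [simp]: "p = (m, f)" "q = (n, g)" "r = (k, h)"
    by (cases p, cases q, cases r)
  have pos: "m > 0" "n > 0" "k > 0"
    and fg: "fls_compose_power f n = fls_compose_power g m"
    and gh: "fls_compose_power g k = fls_compose_power h n"
    using assms by (auto simp: puiseux_rel_def)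
  have "fls_compose_power (fls_compose_power f k) n = fls_compose_power (fls_compose_power f n) k"
    using pos by (simp add: fls_compose_power_compose_power mult.commute)
  also have "\<dots> = fls_compose_power (fls_compose_power g k) m"
    using pos by (simp add: fg fls_compose_power_compose_power mult.commute)
  also have "\<dots> = fls_compose_power (fls_compose_power h m) n"
    using pos by (simp add: gh fls_compose_power_compose_power mult.commute)
  finally show ?thesis
    using pos by (simp add: puiseux_rel_def fls_compose_power_eq_iff)
qed

lemma puiseux_rel_compose_power:
  assumes "puiseux_rel p p'" "n > 0" "n' > 0"
  shows   "fls_compose_power (fls_compose_power (snd p) n) (fst p' * n') =
           fls_compose_power (fls_compose_power (snd p') n') (fst p * n)"
proof -
  have pos: "fst p > 0" "fst p' > 0"
    and eq: "fls_compose_power (snd p) (fst p') = fls_compose_power (snd p') (fst p)"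
    using assms(1) by (auto simp: puiseux_rel_def)
  have "fls_compose_power (fls_compose_power (snd p) n) (fst p' * n') =
        fls_compose_power (fls_compose_power (snd p) (fst p')) (n * n')"
    using pos assms(2,3) by (simp add: fls_compose_power_compose_power mult_ac)
  also have "\<dots> = fls_compose_power (fls_compose_power (snd p') n') (fst p * n)"
    unfolding eq using pos assms(2,3) by (simp add: fls_compose_power_compose_power mult_ac)
  finally show ?thesis .
qed

lemma part_equivp_puiseux_rel: "part_equivp puiseux_rel"
proof (rule part_equivpI)
  show "\<exists>p. puiseux_rel p p"
    by (rule exI[of _ "(1, 0)"]) (simp add: puiseux_rel_def)
  show "symp puiseux_rel"
    by (auto simp: symp_def puiseux_rel_def)
  show "transp puiseux_rel"
    by (auto intro!: transpI dest: puiseux_rel_trans)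
qed

(* otherwise lift_definition descends through fls to coefficient functions *)
lifting_forget fls.lifting

quotient_type (overloaded) 'a puiseux = "nat \<times> 'a :: field fls" / partial: puiseux_rel
  by (rule part_equivp_puiseux_rel)

text \<open>
  \<open>Puiseux m f\<close> is the series \<open>f(z\<^sup>1\<^sup>/\<^sup>m)\<close>; the value for \<open>m = 0\<close> is junk.
\<close>

lift_definition Puiseux :: "nat \<Rightarrow> 'a :: field fls \<Rightarrow> 'a puiseux" is
  "\<lambda>m f. if m = 0 then (1, 0) else (m, f)"
  by (auto simp: puiseux_rel_def)

lemma Puiseux_cases [cases type: puiseux]:
  obtains (Puiseux) m f where "x = Puiseux m f" "m > 0"
  by transfer (auto simp: puiseux_rel_def)

lemma Puiseux_induct [case_names Puiseux, induct type: puiseux]: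
  "(\<And>m f. m > 0 \<Longrightarrow> P (Puiseux m f)) \<Longrightarrow> P x"
  by (cases x) simp

lemma Puiseux_eq_iff:
  "m > 0 \<Longrightarrow> n > 0 \<Longrightarrow>
     Puiseux m f = Puiseux n g \<longleftrightarrow> fls_compose_power f n = fls_compose_power g m"
  by transfer (simp add: puiseux_rel_def)

lemma Puiseux_compose_power:
  "m > 0 \<Longrightarrow> d > 0 \<Longrightarrow> Puiseux (m * d) (fls_compose_power f d) = Puiseux m f"
  by (simp add: Puiseux_eq_iff fls_compose_power_compose_power mult.commute)

lemma Puiseux_common_denominator:
  obtains m f g where "m > 0" "x = Puiseux m f" "y = Puiseux m g"
proof (cases x)
  case (Puiseux m f)
  note x = this
  show ?thesis
  proof (cases y)
    case (Puiseux n g)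
    show ?thesis
    proof (rule that[of "m * n" "fls_compose_power f n" "fls_compose_power g m"])
      show "y = Puiseux (m * n) (fls_compose_power g m)"
        using x Puiseux Puiseux_compose_power[of n m g] by (simp add: mult.commute)
    qed (use x Puiseux in \<open>simp_all add: Puiseux_compose_power\<close>)
  qed
qed

lemma Puiseux_common_denominator3:
  obtains m f g h where "m > 0" "x = Puiseux m f" "y = Puiseux m g" "w = Puiseux m h"
proof -
  obtain m f g where xy: "m > 0" "x = Puiseux m f" "y = Puiseux m g"
    by (rule Puiseux_common_denominator)
  obtain n h where w: "n > 0" "w = Puiseux n h"
    by (cases w)
  show ?thesis
  proof (rule that[of "m * n" "fls_compose_power f n" "fls_compose_power g n" "fls_compose_power h m"])
    show "w = Puiseux (m * n) (fls_compose_power h m)"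
      using xy w Puiseux_compose_power[of n m h] by (simp add: mult.commute)
  qed (use xy w in \<open>simp_all add: Puiseux_compose_power\<close>)
qed

instantiation puiseux :: (field) field
begin

lift_definition zero_puiseux :: "'a puiseux" is "(1, 0)"
  by (simp add: puiseux_rel_def)

lift_definition one_puiseux :: "'a puiseux" is "(1, 1)"
  by (simp add: puiseux_rel_def)

lift_definition uminus_puiseux :: "'a puiseux \<Rightarrow> 'a puiseux" is "\<lambda>p. (fst p, - snd p)"
  by (simp add: puiseux_rel_def)

lift_definition inverse_puiseux :: "'a puiseux \<Rightarrow> 'a puiseux" is "\<lambda>p. (fst p, inverse (snd p))"
  by (auto simp: puiseux_rel_def fls_compose_power_inverse)

lift_definition plus_puiseux :: "'a puiseux \<Rightarrow> 'a puiseux \<Rightarrow> 'a puiseux" is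
  "\<lambda>p q. (fst p * fst q,
     fls_compose_power (snd p) (fst q) + fls_compose_power (snd q) (fst p))"
proof -
  fix p p' q q' :: "nat \<times> 'a fls"
  assume p: "puiseux_rel p p'" and q: "puiseux_rel q q'"
  have pos: "fst p > 0" "fst p' > 0" "fst q > 0" "fst q' > 0"
    using p q by (auto simp: puiseux_rel_def)
  note eqs = puiseux_rel_compose_power[OF p pos(3,4)]
    puiseux_rel_compose_power[OF q pos(1,2), unfolded mult.commute[of "fst q'"] mult.commute[of "fst q"]]
  show "puiseux_rel
     (fst p * fst q, fls_compose_power (snd p) (fst q) + fls_compose_power (snd q) (fst p))
     (fst p' * fst q', fls_compose_power (snd p') (fst q') + fls_compose_power (snd q') (fst p'))"
    using pos eqs by (simp add: puiseux_rel_def)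
qed

lift_definition times_puiseux :: "'a puiseux \<Rightarrow> 'a puiseux \<Rightarrow> 'a puiseux" is
  "\<lambda>p q. (fst p * fst q,
     fls_compose_power (snd p) (fst q) * fls_compose_power (snd q) (fst p))"
proof -
  fix p p' q q' :: "nat \<times> 'a fls"
  assume p: "puiseux_rel p p'" and q: "puiseux_rel q q'"
  have pos: "fst p > 0" "fst p' > 0" "fst q > 0" "fst q' > 0"
    using p q by (auto simp: puiseux_rel_def)
  note eqs = puiseux_rel_compose_power[OF p pos(3,4)]
    puiseux_rel_compose_power[OF q pos(1,2), unfolded mult.commute[of "fst q'"] mult.commute[of "fst q"]]
  show "puiseux_rel
     (fst p * fst q, fls_compose_power (snd p) (fst q) * fls_compose_power (snd q) (fst p))
     (fst p' * fst q', fls_compose_power (snd p') (fst q') * fls_compose_power (snd q') (fst p'))"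
    using pos eqs by (simp add: puiseux_rel_def)
qed

definition minus_puiseux :: "'a puiseux \<Rightarrow> 'a puiseux \<Rightarrow> 'a puiseux" where
  "minus_puiseux x y = x + - y"

definition divide_puiseux :: "'a puiseux \<Rightarrow> 'a puiseux \<Rightarrow> 'a puiseux" where
  "divide_puiseux x y = x * inverse y"

lemma Puiseux_zero: "m > 0 \<Longrightarrow> Puiseux m 0 = 0"
  by transfer (simp add: puiseux_rel_def)

lemma Puiseux_one: "m > 0 \<Longrightarrow> Puiseux m 1 = 1"
  by transfer (simp add: puiseux_rel_def)

lemma Puiseux_uminus: "m > 0 \<Longrightarrow> - Puiseux m f = Puiseux m (- f)"
  by transfer (simp add: puiseux_rel_def)

lemma Puiseux_inverse: "m > 0 \<Longrightarrow> inverse (Puiseux m f) = Puiseux m (inverse f)"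
  by transfer (simp add: puiseux_rel_def)

lemma Puiseux_add: "m > 0 \<Longrightarrow> Puiseux m f + Puiseux m g = Puiseux m (f + g)"
  by transfer (simp add: puiseux_rel_def fls_compose_power_compose_power)

lemma Puiseux_mult: "m > 0 \<Longrightarrow> Puiseux m f * Puiseux m g = Puiseux m (f * g)"
  by transfer (simp add: puiseux_rel_def fls_compose_power_compose_power)

lemma Puiseux_eq_0_iff: "m > 0 \<Longrightarrow> Puiseux m f = 0 \<longleftrightarrow> f = 0"
  by transfer (simp add: puiseux_rel_def)

instance
proof
  fix a b c :: "'a puiseux"
  obtain m f g h where m: "m > 0" and abc: "a = Puiseux m f" "b = Puiseux m g" "c = Puiseux m h"
    by (rule Puiseux_common_denominator3)
  note simps = abc m Puiseux_add Puiseux_mult Puiseux_uminus Puiseux_inverse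
  show "a + b + c = a + (b + c)" by (simp add: simps add.assoc)
  show "a + b = b + a" by (simp add: simps add.commute)
  show "0 + a = a" using m by (simp add: simps flip: Puiseux_zero[OF m])
  show "- a + a = 0" using m by (simp add: simps Puiseux_zero)
  show "a - b = a + - b" by (simp add: minus_puiseux_def)
  show "a * b * c = a * (b * c)" by (simp add: simps mult.assoc)
  show "a * b = b * a" by (simp add: simps mult.commute)
  show "1 * a = a" using m by (simp add: simps flip: Puiseux_one[OF m])
  show "(a + b) * c = a * c + b * c" by (simp add: simps distrib_right)
  show "(0 :: 'a puiseux) \<noteq> 1" by transfer (simp add: puiseux_rel_def)
  show "a \<noteq> 0 \<Longrightarrow> inverse a * a = 1" using m by (simp add: simps Puiseux_eq_0_iff Puiseux_one)
  show "a div b = a * inverse b" by (simp add: divide_puiseux_def)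
  show "inverse (0 :: 'a puiseux) = 0" by transfer (simp add: puiseux_rel_def)
qed

end

text \<open>
  The order in \<open>z\<close>: the least exponent of \<open>z\<close> with nonzero coefficient. As for
  \<^const>\<open>fls_subdegree\<close>, the zero series gets order \<open>0\<close> by convention.
\<close>

lift_definition puiseux_order :: "'a :: field puiseux \<Rightarrow> rat" is
  "\<lambda>p. of_int (fls_subdegree (snd p)) / of_nat (fst p)"
proof -
  fix p q :: "nat \<times> 'a fls"
  assume "puiseux_rel p q"
  hence pos: "fst p > 0" "fst q > 0"
    and eq: "fls_compose_power (snd p) (fst q) = fls_compose_power (snd q) (fst p)"
    by (auto simp: puiseux_rel_def)
  have "int (fst q) * fls_subdegree (snd p) = int (fst p) * fls_subdegree (snd q)"
    using arg_cong[OF eq, of fls_subdegree] pos by (simp add: fls_subdegree_compose_power)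
  hence "of_int (int (fst q) * fls_subdegree (snd p)) =
         (of_int (int (fst p) * fls_subdegree (snd q)) :: rat)"
    by (simp only:)
  with pos show "of_int (fls_subdegree (snd p)) / of_nat (fst p) =
                 (of_int (fls_subdegree (snd q)) / of_nat (fst q) :: rat)"
    by (simp add: field_simps)
qed

definition puiseux_of_fps :: "'a :: field fps \<Rightarrow> 'a puiseux" where
  "puiseux_of_fps f = Puiseux 1 (fps_to_fls f)"

definition puiseux_z :: "'a :: field puiseux" where
  "puiseux_z = Puiseux 1 fls_X"

lemma puiseux_order_Puiseux:
  "m > 0 \<Longrightarrow> puiseux_order (Puiseux m f) = of_int (fls_subdegree f) / of_nat m"
  by transfer simp

lemma puiseux_of_fps_0 [simp]: "puiseux_of_fps 0 = 0"
  and puiseux_of_fps_1 [simp]: "puiseux_of_fps 1 = 1"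
  and puiseux_of_fps_X [simp]: "puiseux_of_fps fps_X = puiseux_z"
  and puiseux_of_fps_add [simp]: "puiseux_of_fps (f + g) = puiseux_of_fps f + puiseux_of_fps g"
  and puiseux_of_fps_mult [simp]: "puiseux_of_fps (f * g) = puiseux_of_fps f * puiseux_of_fps g"
  by (simp_all add: puiseux_of_fps_def puiseux_z_def Puiseux_zero Puiseux_one Puiseux_add
        Puiseux_mult fls_times_fps_to_fls)

lemma puiseux_of_fps_power [simp]: "puiseux_of_fps (f ^ n) = puiseux_of_fps f ^ n"
  by (induction n) simp_all

lemma puiseux_of_fps_eq_iff [simp]: "puiseux_of_fps f = puiseux_of_fps g \<longleftrightarrow> f = g"
  by (simp add: puiseux_of_fps_def Puiseux_eq_iff)


section \<open>Small solutions of the characteristic equation\<close>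

text \<open>
  The equation involves negative powers of \<open>X\<close>, so it only makes sense for \<open>X \<noteq> 0\<close>.
\<close>

definition small_char_solution :: "nat \<Rightarrow> complex fps \<Rightarrow> complex puiseux \<Rightarrow> bool" where
  "small_char_solution d T X \<longleftrightarrow>
     X \<noteq> 0 \<and> puiseux_order X > 0 \<and>
     1 = puiseux_z * puiseux_of_fps T ^ (2 * d) * (\<Sum>l = - int d..int d. X powi l)"

unbundle no fps_syntax

end

theory Submission
  imports Defs
begin

text \<open>
  Writing \<open>u\<^sub>k = 1 - \<lambda>X\<^sup>k\<close>, the product of the \<open>T\<^bsub>j+\<ell>\<^esub>\<close> telescopes to
  \<open>T\<^bsup>2d+1\<^esup> u\<^bsub>j+1\<^esub> u\<^bsub>j+3d+3\<^esub> / (u\<^bsub>j+d+2\<^esub> u\<^bsub>j+2d+2\<^esub>)\<close>. As \<open>zT\<^bsup>2d+1\<^esup> = T - 1\<close>, the recurrence becomes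
  \<open>T u\<^bsub>j+d+1\<^esub> u\<^bsub>j+2d+3\<^esub> = u\<^bsub>j+d+2\<^esub> u\<^bsub>j+2d+2\<^esub> + (T - 1) u\<^bsub>j+1\<^esub> u\<^bsub>j+3d+3\<^esub>\<close>, which is quadratic in \<open>\<lambda>\<close>.
  In each product the exponents sum to \<open>2j+3d+4\<close>, so only the linear coefficient matters, and
  there the difference of the two sides is a multiple of the characteristic equation in the form
  \<open>T(1 - X)X\<^sup>d = (T - 1)(1 - X\<^bsup>2d+1\<^esup>)\<close>.
\<close>

lemma sum_telescope_int:
  fixes f :: "int \<Rightarrow> 'a :: ab_group_add"
  shows "(\<Sum>l = a..a + int n. f l - f (l + 1)) = f a - f (a + int n + 1)"
proof (induction n)
  case (Suc n)
  have "{a..a + int (Suc n)} = insert (a + int n + 1) {a..a + int n}"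
    by auto
  with Suc show ?case
    by (simp add: algebra_simps)
qed simp

lemma prod_telescope_int:
  fixes f :: "int \<Rightarrow> 'a :: field"
  assumes "\<And>l. f l \<noteq> 0"
  shows "(\<Prod>l = a..a + int n. f l / f (l + 1)) = f a / f (a + int n + 1)"
proof (induction n)
  case (Suc n)
  have "{a..a + int (Suc n)} = insert (a + int n + 1) {a..a + int n}"
    by auto
  with Suc assms show ?case
    by (simp add: algebra_simps)
qed simp

text \<open>The factor \<open>1 - X\<close> makes the sum telescope, and \<open>X ^ d\<close> clears
  the negative powers.\<close>

lemma symmetric_geometric_sum:
  fixes X :: "'a :: field"
  assumes "X \<noteq> 0"
  shows "(1 - X) * X ^ d * (\<Sum>l = - int d..int d. X powi l) = 1 - X ^ (2 * d + 1)"
proof -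
  have "(1 - X) * (\<Sum>l = - int d..int d. X powi l) =
        (\<Sum>l = - int d..- int d + int (2 * d). X powi l - X powi (l + 1))"
    using assms by (simp add: sum_distrib_left power_int_add algebra_simps)
  also have "\<dots> = X powi (- int d) - X powi (int d + 1)"
    by (subst sum_telescope_int) simp
  finally have "X ^ d * ((1 - X) * (\<Sum>l = - int d..int d. X powi l)) =
      X powi int d * (X powi (- int d) - X powi (int d + 1))"
    by simp
  also have "\<dots> = 1 - X ^ (2 * d + 1)"
    using assms
    by (simp add: right_diff_distrib power_int_add power_int_minus mult_2 power_add)
  finally show ?thesis
    by (simp add: mult_ac)
qed

text \<open>Multiplying the characteristic equation by \<open>t\<close> produces
  \<open>z * t ^ (2 * d + 1)\<close>, which equals \<open>t - 1\<close>; this eliminates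
  \<open>z\<close>.\<close>

lemma characteristic_equation_closed_form:
  fixes X t z :: "'a :: field"
  assumes "X \<noteq> 0" and "t = 1 + z * t ^ (2 * d + 1)"
    and "1 = z * t ^ (2 * d) * (\<Sum>l = - int d..int d. X powi l)"
  shows "t * (1 - X) * X ^ d = (t - 1) * (1 - X ^ (2 * d + 1))"
proof -
  let ?S = "\<Sum>l = - int d..int d. X powi l"
  have "t = t * (z * t ^ (2 * d) * ?S)"
    using assms(3) by simp
  also have "\<dots> = (z * t ^ (2 * d + 1)) * ?S"
    by simp
  also have "z * t ^ (2 * d + 1) = t - 1"
    using assms(2) by (metis add_diff_cancel_left')
  finally have "t * ((1 - X) * X ^ d) = (t - 1) * ?S * ((1 - X) * X ^ d)"
    by simp
  also have "\<dots> = (t - 1) * ((1 - X) * X ^ d * ?S)"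
    by (simp only: mult_ac)
  finally show ?thesis
    by (simp only: symmetric_geometric_sum[OF assms(1)]) (simp only: mult.assoc)
qed

text \<open>Here \<open>y\<close> and \<open>m\<close> stand for \<open>X\<^sup>d\<close> and \<open>\<lambda>X\<^sup>j\<close>.\<close>

lemma quadratic_recurrence_identity:
  fixes X t y m :: "'a :: field"
  assumes "t * (1 - X) * y = (t - 1) * (1 - X * y ^ 2)"
  shows "t * ((1 - m * (X * y)) * (1 - m * (X ^ 3 * y ^ 2))) =
         (1 - m * (X ^ 2 * y)) * (1 - m * (X ^ 2 * y ^ 2)) +
         (t - 1) * ((1 - m * X) * (1 - m * (X ^ 3 * y ^ 3)))"
  using assms by algebra

text \<open>The algebraic core over any field, later applied with \<open>puiseux_z\<close> for
  \<open>z\<close> and \<open>puiseux_of_fps T\<close> for \<open>t\<close>.\<close>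

lemma recurrence_solution:
  fixes X t z lam :: "'a :: field" and Tj :: "int \<Rightarrow> 'a"
  assumes X: "X \<noteq> 0" and t: "t = 1 + z * t ^ (2 * d + 1)"
    and char: "1 = z * t ^ (2 * d) * (\<Sum>l = - int d..int d. X powi l)"
    and nz: "\<And>k. 1 - lam * X powi k \<noteq> 0"
    and Tj: "\<And>j. Tj j = t *
           (((1 - lam * X powi (int d + 1 + j)) * (1 - lam * X powi (2 * int d + 3 + j))) /
            ((1 - lam * X powi (int d + 2 + j)) * (1 - lam * X powi (2 * int d + 2 + j))))"
  shows "Tj j = 1 + z * (\<Prod>l = - int d..int d. Tj (j + l))"
proof -
  define u where "u k = 1 - lam * X powi k" for k
  have u: "u k \<noteq> 0" for k
    using nz by (simp add: u_def)
  \<comment> \<open>Apart from \<open>t\<close>, each factor is a quotient of two ratios of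
    consecutive values of \<open>u\<close>, so numerator and denominator telescope separately over
    \<open>l\<close>.\<close>
  have factor: "Tj (j + l) = t * (u (int d + 1 + j + l) / u (int d + 1 + j + (l + 1))) /
                  (u (2 * int d + 2 + j + l) / u (2 * int d + 2 + j + (l + 1)))" for l
    unfolding Tj u_def by (simp add: add_ac)
  have telescope: "(\<Prod>l = - int d..int d. u (c + l) / u (c + (l + 1))) = u (c - int d) / u (c + int d + 1)" for c
    using prod_telescope_int[of "\<lambda>l. u (c + l)" "- int d" "2 * d"] u by (simp add: add_ac)
  have "(\<Prod>l = - int d..int d. Tj (j + l)) = t ^ (2 * d + 1) *
          (u (j + 1) / u (2 * int d + 2 + j)) / (u (int d + 2 + j) / u (3 * int d + 3 + j))"
    unfolding factor prod.distrib prod_dividef[where f = "\<lambda>l. t * _ l"] telescope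
    by (simp add: algebra_simps nat_add_distrib nat_mult_distrib)
  hence "1 + z * (\<Prod>l = - int d..int d. Tj (j + l)) = 1 + (z * t ^ (2 * d + 1)) *
          ((u (j + 1) * u (3 * int d + 3 + j)) / (u (int d + 2 + j) * u (2 * int d + 2 + j)))"
    by (simp add: mult_ac)
  also have "z * t ^ (2 * d + 1) = t - 1"
    using t by (metis add_diff_cancel_left')
  also have "1 + (t - 1) *
          ((u (j + 1) * u (3 * int d + 3 + j)) / (u (int d + 2 + j) * u (2 * int d + 2 + j))) =
        (u (int d + 2 + j) * u (2 * int d + 2 + j) + (t - 1) * (u (j + 1) * u (3 * int d + 3 + j))) /
        (u (int d + 2 + j) * u (2 * int d + 2 + j))"
    using u by (simp add: add_divide_distrib)
  also have "u (int d + 2 + j) * u (2 * int d + 2 + j) + (t - 1) * (u (j + 1) * u (3 * int d + 3 + j)) =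
        t * (u (int d + 1 + j) * u (2 * int d + 3 + j))"
  proof -
    define y m where "y = X ^ d" and "m = lam * X powi j"
    \<comment> \<open>With the integer power \<open>X powi j\<close> absorbed into \<open>m\<close>,
      all six values of \<open>u\<close> in the goal become polynomials in \<open>X\<close>,
      \<open>y\<close> and \<open>m\<close>.\<close>
    have shift: "u (int a * int d + int b + j) = 1 - m * (X ^ b * y ^ a)" for a b
    proof -
      have "X powi (int a * int d) = (X ^ d) ^ a"
        by (metis mult.commute of_nat_mult power_int_of_nat power_mult)
      then show ?thesis
        using X by (simp add: u_def m_def y_def power_int_add mult_ac)
    qed
    have "t * (1 - X) * y = (t - 1) * (1 - X * y ^ 2)"
      using characteristic_equation_closed_form[OF X t char]
      by (simp add: y_def power_mult[symmetric] mult.commute)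
    from quadratic_recurrence_identity[OF this, of m] show ?thesis
      using shift[of 1 2] shift[of 2 2] shift[of 0 1] shift[of 3 3] shift[of 1 1] shift[of 2 3]
      by (simp add: add_ac)
  qed
  also have "t * (u (int d + 1 + j) * u (2 * int d + 3 + j)) /
      (u (int d + 2 + j) * u (2 * int d + 2 + j)) = Tj j"
    unfolding Tj u_def by simp
  finally show ?thesis ..
qed

theorem lemma3:
  fixes d :: nat and T :: "complex fps" and X :: "complex puiseux"
    and lam :: "complex puiseux" and Tj :: "int \<Rightarrow> complex puiseux"
  assumes "d \<ge> 1"
    and "fps_nth T 0 = 1"
    and "T = 1 + fps_X * T ^ (2 * d + 1)"
    and "small_char_solution d T X"
    and "\<And>k :: int. 1 - lam * X powi k \<noteq> 0"
    and "\<And>j :: int. Tj j = puiseux_of_fps T *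
           (((1 - lam * X powi (int d + 1 + j)) * (1 - lam * X powi (2 * int d + 3 + j))) /
            ((1 - lam * X powi (int d + 2 + j)) * (1 - lam * X powi (2 * int d + 2 + j))))"
  shows "\<forall>j :: int. Tj j = 1 + puiseux_z * (\<Prod>l = - int d..int d. Tj (j + l))"
proof
  fix j :: int
  \<comment> \<open>The embedding of power series is a ring homomorphism, so it carries over the
    equation for \<open>T\<close>.\<close>
  have T: "puiseux_of_fps T = 1 + puiseux_z * puiseux_of_fps T ^ (2 * d + 1)"
    using arg_cong[OF assms(3), of puiseux_of_fps] by simp
  from assms(4) have "X \<noteq> 0"
    and "1 = puiseux_z * puiseux_of_fps T ^ (2 * d) * (\<Sum>l = - int d..int d. X powi l)"
    unfolding small_char_solution_def by blast+
  from recurrence_solution[OF this(1) T this(2) assms(5,6)]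
  show "Tj j = 1 + puiseux_z * (\<Prod>l = - int d..int d. Tj (j + l))" .
qed

end
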